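(* For $k\leq K$, let $\mathcal X_k$ be nonempty convex subsets of Euclidean spaces $E_k$, let $F_k:\mathcal X_k\to E_k$ be continuous monotone vector fields, and let $$X_kx_k+G_kg_k+t_kT_k+U_ku_k\leq_{\mathbf K_k}a_k,\quad 1\leq k\leq K\qquad[\mathbf K_k\in\mathcal K]$$ be $\mathcal K$-representations of $(F_k,\mathcal X_k)$. Put $F([x_1;\dots;x_K])=[F_1(x_1);\dots;F_K(x_K)]$ and $\mathcal X=\mathcal X_1\times\dots\times\mathcal X_K$. Then the conic constraint $$X_kx_k+G_kg_k+t_kT_k+U_ku_k\leq_{\mathbf K_k}a_k,\ k\leq K,\qquad t=\sum_kt_k$$ in variables $t$, $g:=[g_1;\dots;g_K]$, $x:=[x_1;\dots;x_K]$, $t_1,\dots,t_K$, $u_1,\dots,u_K$ is a $\mathcal K$-representation of $(F,\mathcal X)$. If the given constraints are almost $\mathcal K$-representations of $(F_k,\mathcal X_k)$, then the resulting constraint is an almost $\mathcal K$-representation of $(F,\mathcal X)$.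
   Context: $\mathcal K$ is a fixed family of regular cones (closed, convex, pointed, with nonempty interior) in Euclidean spaces which contains $\mathbb R_+$, is closed under finite direct products, and is closed under passing to dual cones. $a\leq_{\mathbf K}b$ means $b-a\in\mathbf K$. $[a;b]$ denotes vertical concatenation. Finite systems of conic constraints with cones from $\mathcal K$, linear equalities and nonstrict linear inequalities are equivalent to a single conic constraint with a cone from $\mathcal K$. Let $\mathcal X$ be a nonempty convex subset of a Euclidean space $E$. A vector field $F:\mathcal X\to E$ is monotone if $\langle F(x)-F(y),x-y\rangle\geq0$ for all $x,y\in\mathcal X$. For continuous monotone $F$ put $$\mathcal F[F,\mathcal X]=\{[t;g;x]\in\mathbb R\times E\times E: x\in\mathcal X,\ t-\langle g,y\rangle\geq\langle F(y),x-y\rangle\ \forall y\in\mathcal X\}.$$ A conic constraint $Xx+Gg+tT+Uu\leq_{\mathbf K}a$, $\mathbf K\in\mathcal K$ (or an equivalent finite system), in variables $t,g,x$ and additional variables $u$, with projection $\mathcal T$ of its solution set on the space of $[t;g;x]$, is a $\mathcal K$-representation of $(F,\mathcal X)$ if (i) $\mathcal T\subset\mathcal F[F,\mathcal X]$ and $[t;g;x]\in\mathcal T$, $t'\geq t$ imply $[t';g;x]\in\mathcal T$; and (ii) $\mathcal T\supset\{[\langle F(x),x\rangle;F(x);x]:x\in\mathcal X\}$. It is an almost $\mathcal K$-representation if (i) holds and (ii') $\mathcal T\supset\{[t;F(x);x]:x\in\mathcal X,\ t>\langle F(x),x\rangle\}$. *)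

theory Defs
  imports "HOL-Analysis.Analysis" "HOL-Library.Function_Algebras"
begin

text \<open>
  Cones of varying dimension live in \<open>Euclidean_space n\<close>, whose points are the functions
  \<open>nat \<Rightarrow> real\<close> vanishing from index \<open>n\<close> on. Addition on functions comes from
  \<open>Function_Algebras\<close>; scalar multiplication is pointwise as well, so that the
  library notions \<open>convex\<close>, \<open>cone\<close> and \<open>linear\<close> apply.
\<close>

instantiation "fun" :: (type, real_vector) real_vector
begin

definition scaleR_fun :: "real \<Rightarrow> ('a \<Rightarrow> 'b) \<Rightarrow> 'a \<Rightarrow> 'b"
  where "scaleR_fun r f = (\<lambda>i. r *\<^sub>R f i)"

instance
  by standard (auto simp: scaleR_fun_def fun_eq_iff scaleR_add_right scaleR_add_left)

end

abbreviation Rn :: "nat \<Rightarrow> (nat \<Rightarrow> real) set"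
  where "Rn n \<equiv> topspace (Euclidean_space n)"

definition regular_cone :: "nat \<Rightarrow> (nat \<Rightarrow> real) set \<Rightarrow> bool"
  where "regular_cone n K \<longleftrightarrow>
    cone K \<and> convex K \<and> closedin (Euclidean_space n) K \<and>
    K \<inter> uminus ` K = {0} \<and> Euclidean_space n interior_of K \<noteq> {}"

definition dual_cone :: "nat \<Rightarrow> (nat \<Rightarrow> real) set \<Rightarrow> (nat \<Rightarrow> real) set"
  where "dual_cone n K = {y \<in> Rn n. \<forall>x\<in>K. (\<Sum>i<n. y i * x i) \<ge> 0}"

definition vconcat :: "nat \<Rightarrow> (nat \<Rightarrow> real) \<Rightarrow> (nat \<Rightarrow> real) \<Rightarrow> nat \<Rightarrow> real"
  where "vconcat n x y = (\<lambda>i. if i < n then x i else y (i - n))"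

definition cone_prod :: "nat \<Rightarrow> (nat \<Rightarrow> real) set \<Rightarrow> (nat \<Rightarrow> real) set \<Rightarrow> (nat \<Rightarrow> real) set"
  where "cone_prod n K L = {vconcat n x y | x y. x \<in> K \<and> y \<in> L}"

text \<open>
  \<open>\<K> n\<close> collects the members of the family lying in \<open>n\<close>-dimensional space. Since
  concatenation is associative, closure under binary products is closure under (nonempty)
  finite products.
\<close>

definition cone_family :: "(nat \<Rightarrow> (nat \<Rightarrow> real) set set) \<Rightarrow> bool"
  where "cone_family \<K> \<longleftrightarrow>
    (\<forall>n. \<forall>K\<in>\<K> n. regular_cone n K) \<and>
    {x \<in> Rn 1. x 0 \<ge> 0} \<in> \<K> 1 \<and>
    (\<forall>n m. \<forall>K\<in>\<K> n. \<forall>L\<in>\<K> m. cone_prod n K L \<in> \<K> (n + m)) \<and>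
    (\<forall>n. \<forall>K\<in>\<K> n. dual_cone n K \<in> \<K> n)"

definition cone_le :: "(nat \<Rightarrow> real) set \<Rightarrow> (nat \<Rightarrow> real) \<Rightarrow> (nat \<Rightarrow> real) \<Rightarrow> bool"
  where "cone_le K a b \<longleftrightarrow> b - a \<in> K"

text \<open>
  Constraints in variables \<open>t\<close>, \<open>g\<close>, \<open>x\<close> and additional variables \<open>u\<close>. The arguments of
  each constructor are, after the dimension and the cone in the conic case, the linear maps
  applied to \<open>x\<close> and \<open>g\<close>, the coefficient of \<open>t\<close>, the linear map applied to \<open>u\<close>, and the
  right-hand side.
\<close>

datatype ('e, 'u) constraint =
    Conic nat "(nat \<Rightarrow> real) set" "'e \<Rightarrow> nat \<Rightarrow> real" "'e \<Rightarrow> nat \<Rightarrow> real" "nat \<Rightarrow> real"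
      "'u \<Rightarrow> nat \<Rightarrow> real" "nat \<Rightarrow> real"
  | LinEq "'e \<Rightarrow> real" "'e \<Rightarrow> real" real "'u \<Rightarrow> real" real
  | LinLe "'e \<Rightarrow> real" "'e \<Rightarrow> real" real "'u \<Rightarrow> real" real

text \<open>
  A Euclidean space is a linear subspace, with the induced inner product, of a type of class
  \<open>euclidean_space\<close>. This lets finite families of Euclidean spaces of different (possibly
  zero) dimensions be indexed by a finite type: \<open>E\<close> is the space of \<open>x\<close> and \<open>g\<close>, and \<open>U\<close>
  the space of \<open>u\<close>.
\<close>

fun K_constraint :: "(nat \<Rightarrow> (nat \<Rightarrow> real) set set) \<Rightarrow> 'e::euclidean_space set \<Rightarrow>
    'u::euclidean_space set \<Rightarrow> ('e, 'u) constraint \<Rightarrow> bool"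
  where
    "K_constraint \<K> E U (Conic n K X G T B a) \<longleftrightarrow>
      K \<in> \<K> n \<and> linear X \<and> X ` E \<subseteq> Rn n \<and> linear G \<and> G ` E \<subseteq> Rn n \<and> T \<in> Rn n \<and>
      linear B \<and> B ` U \<subseteq> Rn n \<and> a \<in> Rn n"
  | "K_constraint \<K> E U (LinEq X G T B a) \<longleftrightarrow> linear X \<and> linear G \<and> linear B"
  | "K_constraint \<K> E U (LinLe X G T B a) \<longleftrightarrow> linear X \<and> linear G \<and> linear B"

fun satisfies :: "real \<Rightarrow> 'e \<Rightarrow> 'e \<Rightarrow> 'u \<Rightarrow> ('e, 'u) constraint \<Rightarrow> bool"
  where
    "satisfies t g x u (Conic n K X G T B a) \<longleftrightarrow> cone_le K (X x + G g + t *\<^sub>R T + B u) a"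
  | "satisfies t g x u (LinEq X G T B a) \<longleftrightarrow> X x + G g + t * T + B u = a"
  | "satisfies t g x u (LinLe X G T B a) \<longleftrightarrow> X x + G g + t * T + B u \<le> a"

definition solution_set :: "'e set \<Rightarrow> 'u set \<Rightarrow> ('e, 'u) constraint set \<Rightarrow> (real \<times> 'e \<times> 'e \<times> 'u) set"
  where "solution_set E U S =
    {(t, g, x, u). g \<in> E \<and> x \<in> E \<and> u \<in> U \<and> (\<forall>c\<in>S. satisfies t g x u c)}"

definition projection :: "'e set \<Rightarrow> 'u set \<Rightarrow> ('e, 'u) constraint set \<Rightarrow> (real \<times> 'e \<times> 'e) set"
  where "projection E U S = {(t, g, x). \<exists>u. (t, g, x, u) \<in> solution_set E U S}"

text \<open>
  Finite systems that are equivalent to a single conic constraint with a cone from the family.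
\<close>

definition K_system :: "(nat \<Rightarrow> (nat \<Rightarrow> real) set set) \<Rightarrow> 'e::euclidean_space set \<Rightarrow>
    'u::euclidean_space set \<Rightarrow> ('e, 'u) constraint set \<Rightarrow> bool"
  where "K_system \<K> E U S \<longleftrightarrow>
    finite S \<and> (\<forall>c\<in>S. K_constraint \<K> E U c) \<and>
    (\<exists>n K X G T B a. K_constraint \<K> E U (Conic n K X G T B a) \<and>
       solution_set E U {Conic n K X G T B a} = solution_set E U S)"

definition monotone_field :: "'e::euclidean_space set \<Rightarrow> 'e set \<Rightarrow> ('e \<Rightarrow> 'e) \<Rightarrow> bool"
  where "monotone_field E X F \<longleftrightarrow>
    subspace E \<and> X \<subseteq> E \<and> X \<noteq> {} \<and> convex X \<and> F ` X \<subseteq> E \<and> continuous_on X F \<and>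
    (\<forall>x\<in>X. \<forall>y\<in>X. (F x - F y) \<bullet> (x - y) \<ge> 0)"

definition FF :: "'e::euclidean_space set \<Rightarrow> ('e \<Rightarrow> 'e) \<Rightarrow> 'e set \<Rightarrow> (real \<times> 'e \<times> 'e) set"
  where "FF E F X =
    {(t, g, x). g \<in> E \<and> x \<in> X \<and> (\<forall>y\<in>X. t - g \<bullet> y \<ge> F y \<bullet> (x - y))}"

definition rep_sound :: "'e::euclidean_space set \<Rightarrow> ('e \<Rightarrow> 'e) \<Rightarrow> 'e set \<Rightarrow> (real \<times> 'e \<times> 'e) set \<Rightarrow> bool"
  where "rep_sound E F X P \<longleftrightarrow>
    P \<subseteq> FF E F X \<and> (\<forall>t g x t'. (t, g, x) \<in> P \<and> t' \<ge> t \<longrightarrow> (t', g, x) \<in> P)"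

definition K_representation :: "(nat \<Rightarrow> (nat \<Rightarrow> real) set set) \<Rightarrow> 'e::euclidean_space set \<Rightarrow>
    'u::euclidean_space set \<Rightarrow> ('e, 'u) constraint set \<Rightarrow> ('e \<Rightarrow> 'e) \<Rightarrow> 'e set \<Rightarrow> bool"
  where "K_representation \<K> E U S F X \<longleftrightarrow>
    monotone_field E X F \<and> subspace U \<and> K_system \<K> E U S \<and>
    rep_sound E F X (projection E U S) \<and>
    {(F x \<bullet> x, F x, x) | x. x \<in> X} \<subseteq> projection E U S"

definition almost_K_representation :: "(nat \<Rightarrow> (nat \<Rightarrow> real) set set) \<Rightarrow> 'e::euclidean_space set \<Rightarrow>
    'u::euclidean_space set \<Rightarrow> ('e, 'u) constraint set \<Rightarrow> ('e \<Rightarrow> 'e) \<Rightarrow> 'e set \<Rightarrow> bool"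
  where "almost_K_representation \<K> E U S F X \<longleftrightarrow>
    monotone_field E X F \<and> subspace U \<and> K_system \<K> E U S \<and>
    rep_sound E F X (projection E U S) \<and>
    {(t, F x, x) | t x. x \<in> X \<and> t > F x \<bullet> x} \<subseteq> projection E U S"

definition block_prod :: "('k::finite \<Rightarrow> 'a set) \<Rightarrow> ('a ^ 'k) set"
  where "block_prod S = {x. \<forall>k. x $ k \<in> S k}"

definition block_field :: "('k::finite \<Rightarrow> 'e \<Rightarrow> 'e) \<Rightarrow> 'e ^ 'k \<Rightarrow> 'e ^ 'k"
  where "block_field F x = (\<chi> k. F k (x $ k))"

text \<open>The additional variables of the product system are the pair \<open>([t\<^sub>k]\<^sub>k, [u\<^sub>k]\<^sub>k)\<close>.\<close>

definition product_system :: "('k::finite \<Rightarrow> nat) \<Rightarrow> ('k \<Rightarrow> (nat \<Rightarrow> real) set) \<Rightarrow>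
    ('k \<Rightarrow> 'e::euclidean_space \<Rightarrow> nat \<Rightarrow> real) \<Rightarrow> ('k \<Rightarrow> 'e \<Rightarrow> nat \<Rightarrow> real) \<Rightarrow> ('k \<Rightarrow> nat \<Rightarrow> real) \<Rightarrow>
    ('k \<Rightarrow> 'u::euclidean_space \<Rightarrow> nat \<Rightarrow> real) \<Rightarrow> ('k \<Rightarrow> nat \<Rightarrow> real) \<Rightarrow>
    ('e ^ 'k, (real ^ 'k) \<times> ('u ^ 'k)) constraint set"
  where "product_system n K X G T B a =
    range (\<lambda>k. Conic (n k) (K k) (\<lambda>x. X k (x $ k)) (\<lambda>g. G k (g $ k)) 0
                 (\<lambda>(s, u). (s $ k) *\<^sub>R T k + B k (u $ k)) (a k))
    \<union> {LinEq (\<lambda>_. 0) (\<lambda>_. 0) 1 (\<lambda>(s, u). - (\<Sum>k\<in>UNIV. s $ k)) 0}"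

end

theory Submission
  imports Defs
begin

text \<open>
  Projecting the product system leaves the points \<open>(\<Sum>k. s\<^sub>k, g, x)\<close> whose blocks
  \<open>(s\<^sub>k, g\<^sub>k, x\<^sub>k)\<close> lie in the given projections. Since inner products split into sums over
  blocks, the inequalities defining \<open>FF\<close> add up, and any surplus of \<open>t\<close> over the sum of the
  required \<open>s\<^sub>k\<close> can be shared among the blocks.
\<close>

section \<open>Finite systems as single conic constraints\<close>

lemma Rn_iff: "x \<in> Rn n \<longleftrightarrow> (\<forall>i\<ge>n. x i = 0)"
  by (simp add: topspace_Euclidean_space)

lemma Rn_zero: "0 \<in> Rn n"
  by (simp add: Rn_iff)

lemma Rn_add: "x \<in> Rn n \<Longrightarrow> y \<in> Rn n \<Longrightarrow> x + y \<in> Rn n"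
  by (simp add: Rn_iff)

lemma Rn_diff: "x \<in> Rn n \<Longrightarrow> y \<in> Rn n \<Longrightarrow> x - y \<in> Rn n"
  by (simp add: Rn_iff)

lemma Rn_scaleR: "x \<in> Rn n \<Longrightarrow> r *\<^sub>R x \<in> Rn n"
  by (simp add: Rn_iff scaleR_fun_def)

lemma vconcat_Rn: "y \<in> Rn m \<Longrightarrow> vconcat n x y \<in> Rn (n + m)"
  by (auto simp: Rn_iff vconcat_def)

lemma vconcat_add: "vconcat n (x + x') (y + y') = vconcat n x y + vconcat n x' y'"
  by (auto simp: vconcat_def fun_eq_iff)

lemma vconcat_diff: "vconcat n (x - x') (y - y') = vconcat n x y - vconcat n x' y'"
  by (auto simp: vconcat_def fun_eq_iff)

lemma vconcat_scaleR: "vconcat n (r *\<^sub>R x) (r *\<^sub>R y) = r *\<^sub>R vconcat n x y"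
  by (auto simp: vconcat_def fun_eq_iff scaleR_fun_def)

lemma linear_vconcat:
  assumes "linear f" "linear g"
  shows "linear (\<lambda>x. vconcat n (f x) (g x))"
  using assms by (simp add: linear_iff vconcat_add vconcat_scaleR)

text \<open>\<open>vconcat n\<close> reads only the first \<open>n\<close> entries of its first
  argument, so that argument is recovered once it is known to vanish from \<open>n\<close> on; the
  second is shifted but kept whole.\<close>

lemma vconcat_inject:
  assumes "x \<in> Rn n" "x' \<in> Rn n"
  shows "vconcat n x y = vconcat n x' y' \<longleftrightarrow> x = x' \<and> y = y'"
proof
  assume eq: "vconcat n x y = vconcat n x' y'"
  have "x i = x' i" for i
    using fun_cong[OF eq, of i] assms by (cases "i < n") (auto simp: vconcat_def Rn_iff)
  moreover have "y i = y' i" for i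
    using fun_cong[OF eq, of "n + i"] by (simp add: vconcat_def)
  ultimately show "x = x' \<and> y = y'" by auto
qed simp

text \<open>Membership in a product cone only provides some decomposition into members of
  \<open>K\<close> and \<open>L\<close>. Both first blocks lie in \<open>Rn n\<close>, so this
  decomposition is the given one.\<close>

lemma vconcat_mem_cone_prod:
  assumes "K \<subseteq> Rn n" "x \<in> Rn n"
  shows "vconcat n x y \<in> cone_prod n K L \<longleftrightarrow> x \<in> K \<and> y \<in> L"
proof
  assume "vconcat n x y \<in> cone_prod n K L"
  then obtain x' y' where "vconcat n x y = vconcat n x' y'" "x' \<in> K" "y' \<in> L"
    by (auto simp: cone_prod_def)
  moreover from this assms have "x' \<in> Rn n" by blast
  ultimately show "x \<in> K \<and> y \<in> L"
    using vconcat_inject[OF assms(2)] by simp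
qed (auto simp: cone_prod_def)

lemma cone_family_subset_Rn:
  assumes "cone_family \<K>" "K \<in> \<K> n"
  shows "K \<subseteq> Rn n"
proof -
  have "regular_cone n K" using assms by (simp add: cone_family_def)
  then have "closedin (Euclidean_space n) K" by (simp add: regular_cone_def)
  then show ?thesis by (rule closedin_subset)
qed

text \<open>The existential clause of \<open>K_system\<close> on its own, so that it can be
  established one constraint at a time.\<close>

definition conic_representable where
  "conic_representable \<K> E U S \<longleftrightarrow>
    (\<exists>n K X G T B a. K_constraint \<K> E U (Conic n K X G T B a) \<and>
       solution_set E U {Conic n K X G T B a} = solution_set E U S)"

lemma solution_set_Un:
  "solution_set E U (S \<union> S') = solution_set E U S \<inter> solution_set E U S'"
  by (auto simp: solution_set_def)

text \<open>Supplies the condition on the first block under which membership in a product cone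
  splits into two memberships.\<close>

lemma conic_residual_Rn:
  assumes "K_constraint \<K> E U (Conic n K X G T B a)" "x \<in> E" "g \<in> E" "u \<in> U"
  shows "a - (X x + G g + t *\<^sub>R T + B u) \<in> Rn n"
proof -
  have "X x \<in> Rn n" "G g \<in> Rn n" "B u \<in> Rn n" "T \<in> Rn n" "a \<in> Rn n"
    using assms by auto
  then show ?thesis by (intro Rn_diff Rn_add Rn_scaleR)
qed

text \<open>Two conic constraints stacked on top of each other form one constraint whose cone is the
  product of the two cones, and the family is closed under such products.\<close>

lemma conic_representable_Un:
  fixes E :: "'e::euclidean_space set" and U :: "'u::euclidean_space set"
  assumes fam: "cone_family \<K>"
    and "conic_representable \<K> E U S" "conic_representable \<K> E U S'"
  shows "conic_representable \<K> E U (S \<union> S')"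
proof -
  obtain n K X G T B a where
    c: "K_constraint \<K> E U (Conic n K X G T B a)"
    and s: "solution_set E U {Conic n K X G T B a} = solution_set E U S"
    using assms(2) unfolding conic_representable_def by blast
  obtain n' K' X' G' T' B' a' where
    c': "K_constraint \<K> E U (Conic n' K' X' G' T' B' a')"
    and s': "solution_set E U {Conic n' K' X' G' T' B' a'} = solution_set E U S'"
    using assms(3) unfolding conic_representable_def by blast
  let ?C = "Conic (n + n') (cone_prod n K K') (\<lambda>x. vconcat n (X x) (X' x))
    (\<lambda>g. vconcat n (G g) (G' g)) (vconcat n T T') (\<lambda>u. vconcat n (B u) (B' u)) (vconcat n a a')"
  have K: "K \<subseteq> Rn n" using c fam cone_family_subset_Rn by auto
  have "cone_prod n K K' \<in> \<K> (n + n')"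
    using c c' fam by (simp add: cone_family_def)
  then have 1: "K_constraint \<K> E U ?C"
    using c c' by (auto intro!: linear_vconcat vconcat_Rn)
  \<comment> \<open>The residual of the stacked constraint is the concatenation of the two
    residuals. Restricting to \<open>E\<close> and \<open>U\<close> places the first residual in
    \<open>Rn n\<close>, and a solution set contains only such points.\<close>
  have "satisfies t g x u ?C \<longleftrightarrow>
      satisfies t g x u (Conic n K X G T B a) \<and> satisfies t g x u (Conic n' K' X' G' T' B' a')"
    if "g \<in> E" "x \<in> E" "u \<in> U" for t g x u
    using vconcat_mem_cone_prod[OF K conic_residual_Rn[OF c that(2,1,3), of t]]
    by (simp add: cone_le_def flip: vconcat_add vconcat_diff vconcat_scaleR)
  then have "solution_set E U {?C} = solution_set E U {Conic n K X G T B a} \<inter>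
      solution_set E U {Conic n' K' X' G' T' B' a'}"
    unfolding solution_set_def by auto
  then have "solution_set E U {?C} = solution_set E U (S \<union> S')"
    by (simp only: s s' solution_set_Un)
  with 1 show ?thesis unfolding conic_representable_def by blast
qed

lemma linear_single:
  fixes f :: "'v::real_vector \<Rightarrow> real"
  assumes "linear f"
  shows "linear (\<lambda>v i. if i = j then f v else 0)"
  using assms by (auto simp: linear_iff fun_eq_iff scaleR_fun_def)

text \<open>A scalar inequality is a conic constraint for the half-line of nonnegative reals, a
  member of the family; \<open>?e\<close> places a scalar in coordinate 0 of the one-dimensional
  space.\<close>

lemma conic_representable_LinLe:
  fixes E :: "'e::euclidean_space set" and U :: "'u::euclidean_space set"
  assumes fam: "cone_family \<K>" and lin: "linear X" "linear G" "linear B"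
  shows "conic_representable \<K> E U {LinLe X G T B a}"
proof -
  let ?e = "\<lambda>r i::nat. if i = 0 then r else (0::real)"
  let ?C = "Conic 1 {x \<in> Rn 1. x 0 \<ge> 0} (\<lambda>x. ?e (X x)) (\<lambda>g. ?e (G g)) (?e T)
    (\<lambda>u. ?e (B u)) (?e a)"
  have "{x \<in> Rn 1. x 0 \<ge> 0} \<in> \<K> 1"
    using fam by (simp only: cone_family_def)
  then have 1: "K_constraint \<K> E U ?C"
    by (simp only: K_constraint.simps)
      (auto simp: Rn_iff intro!: linear_single lin)
  have "satisfies t g x u ?C \<longleftrightarrow> satisfies t g x u (LinLe X G T B a)" for t g x u
    by (auto simp: cone_le_def Rn_iff scaleR_fun_def)
  then have "solution_set E U {?C} = solution_set E U {LinLe X G T B a}"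
    unfolding solution_set_def by auto
  with 1 show ?thesis unfolding conic_representable_def by blast
qed

lemma conic_representable_K_constraint:
  fixes E :: "'e::euclidean_space set" and U :: "'u::euclidean_space set"
  assumes fam: "cone_family \<K>" and c: "K_constraint \<K> E U c"
  shows "conic_representable \<K> E U {c}"
proof (cases c)
  case Conic
  then show ?thesis using c unfolding conic_representable_def by blast
next
  case (LinLe X G T B a)
  then show ?thesis using c fam conic_representable_LinLe by auto
next
  case (LinEq X G T B a)
  then have "linear X" "linear G" "linear B" using c by auto
  \<comment> \<open>The equality is replaced by two opposite inequalities.\<close>
  then have "conic_representable \<K> E U
      ({LinLe X G T B a} \<union> {LinLe (\<lambda>x. - X x) (\<lambda>g. - G g) (- T) (\<lambda>u. - B u) (- a)})"
    by (intro conic_representable_Un conic_representable_LinLe fam linear_compose_neg)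
  moreover have "solution_set E U
      ({LinLe X G T B a} \<union> {LinLe (\<lambda>x. - X x) (\<lambda>g. - G g) (- T) (\<lambda>u. - B u) (- a)}) =
      solution_set E U {c}"
    by (auto simp: solution_set_def LinEq)
  ultimately show ?thesis unfolding conic_representable_def by metis
qed

lemma finite_conic_representable:
  fixes E :: "'e::euclidean_space set" and U :: "'u::euclidean_space set"
  assumes fam: "cone_family \<K>" and "finite S" "\<And>c. c \<in> S \<Longrightarrow> K_constraint \<K> E U c"
  shows "conic_representable \<K> E U S"
  using assms(2,3)
proof (induction rule: finite_induct)
  case empty
  \<comment> \<open>Even the empty system has to be matched by an actual constraint; the inequality
    0 \<le> 0 holds everywhere.\<close>
  let ?c = "LinLe (\<lambda>_. 0) (\<lambda>_. 0) 0 (\<lambda>_. 0) 0 :: ('e, 'u) constraint"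
  have "conic_representable \<K> E U {?c}"
    by (intro conic_representable_LinLe fam linear_zero)
  moreover have "solution_set E U {?c} = solution_set E U {}"
    by (simp add: solution_set_def)
  ultimately show ?case unfolding conic_representable_def by metis
next
  case (insert c S)
  then have "conic_representable \<K> E U ({c} \<union> S)"
    by (intro conic_representable_Un conic_representable_K_constraint fam) auto
  then show ?case by simp
qed

text \<open>Over a cone family the existence of an equivalent single conic constraint is automatic,
  so for the product system only finiteness and each separate constraint remain to be
  checked.\<close>

lemma K_system_iff:
  assumes "cone_family \<K>"
  shows "K_system \<K> E U S \<longleftrightarrow> finite S \<and> (\<forall>c\<in>S. K_constraint \<K> E U c)"
  using finite_conic_representable[OF assms, of S E U]
  unfolding K_system_def conic_representable_def by blast

section \<open>Products of representations\<close>

lemma subspace_block_prod: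
  assumes "\<And>k. subspace (S k)"
  shows "subspace (block_prod S)"
  using assms by (auto simp: subspace_def block_prod_def)

text \<open>Every clause reduces to the blocks: a point is chosen in each block for nonemptiness,
  continuity is checked per coordinate, and the monotonicity inner product is a sum of nonnegative
  block terms.\<close>

lemma monotone_field_block:
  fixes F :: "'k::finite \<Rightarrow> 'e::euclidean_space \<Rightarrow> 'e"
  assumes "\<And>k. monotone_field (E k) (\<X> k) (F k)"
  shows "monotone_field (block_prod E) (block_prod \<X>) (block_field F)"
proof -
  have mem: "x \<in> E k \<and> F k x \<in> E k" if "x \<in> \<X> k" for k x
    using assms[of k] that unfolding monotone_field_def by blast
  have conv: "convex (\<X> k)" for k
    using assms by (simp add: monotone_field_def)
  have "subspace (block_prod E)"
    using assms by (intro subspace_block_prod) (simp add: monotone_field_def)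
  moreover have "block_prod \<X> \<subseteq> block_prod E" "block_field F ` block_prod \<X> \<subseteq> block_prod E"
    using mem by (auto simp: block_prod_def block_field_def)
  moreover have "block_prod \<X> \<noteq> {}"
  proof -
    have "\<forall>k. \<exists>x. x \<in> \<X> k"
      using assms unfolding monotone_field_def by blast
    then obtain x where "\<forall>k. x k \<in> \<X> k" by metis
    then have "(\<chi> k. x k) \<in> block_prod \<X>" by (simp add: block_prod_def)
    then show ?thesis by blast
  qed
  moreover have "convex (block_prod \<X>)"
    using conv by (auto simp: convex_def block_prod_def)
  moreover have "continuous_on (block_prod \<X>) (block_field F)"
    unfolding block_field_def
  proof (intro continuous_on_vec_lambda)
    fix k
    have "continuous_on (\<X> k) (F k)" using assms by (simp add: monotone_field_def)
    then show "continuous_on (block_prod \<X>) (\<lambda>x. F k (x $ k))"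
      by (rule continuous_on_compose2) (auto simp: block_prod_def intro!: continuous_intros)
  qed
  moreover have "(block_field F x - block_field F y) \<bullet> (x - y) \<ge> 0"
    if "x \<in> block_prod \<X>" "y \<in> block_prod \<X>" for x y
    unfolding inner_vec_def
    using that assms by (intro sum_nonneg) (simp add: monotone_field_def block_prod_def block_field_def)
  ultimately show ?thesis unfolding monotone_field_def by blast
qed

lemma K_system_product_system:
  fixes U :: "'k::finite \<Rightarrow> 'u::euclidean_space set"
    and E :: "'k \<Rightarrow> 'e::euclidean_space set"
  assumes fam: "cone_family \<K>"
    and c: "\<And>k. K_constraint \<K> (E k) (U k) (Conic (n k) (K k) (X k) (G k) (T k) (B k) (a k))"
  shows "K_system \<K> (block_prod E) (UNIV \<times> block_prod U) (product_system n K X G T B a)"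
proof -
  have lin: "linear (X k)" "linear (G k)" "linear (B k)" for k using c[of k] by auto
  have "linear (\<lambda>x. f (x $ k))" if "linear f"
    for f :: "'v::real_vector \<Rightarrow> nat \<Rightarrow> real" and k :: 'k
    using that by (simp add: linear_iff)
  \<comment> \<open>Each block's own \<open>t\<close>-variable is an additional variable of the
    product system, so the vector \<open>T k\<close> moves from the coefficient of \<open>t\<close>
    into the linear map on \<open>(s, u)\<close>.\<close>
  moreover have "linear (\<lambda>(s, u). (s $ k) *\<^sub>R T k + B k (u $ k))" for k
    using lin(3)[of k]
    by (auto simp: linear_iff algebra_simps)
  ultimately have "K_constraint \<K> (block_prod E) (UNIV \<times> block_prod U)
      (Conic (n k) (K k) (\<lambda>x. X k (x $ k)) (\<lambda>g. G k (g $ k)) 0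
        (\<lambda>(s, u). (s $ k) *\<^sub>R T k + B k (u $ k)) (a k))" for k
    using c[of k]
    by (auto simp: block_prod_def
        intro!: Rn_zero Rn_add Rn_scaleR)
  moreover have "linear (\<lambda>(s :: real ^ 'k, u :: 'u ^ 'k). - (\<Sum>k\<in>UNIV. s $ k))"
    by (auto simp: linear_iff sum.distrib sum_distrib_left)
  ultimately show ?thesis
    unfolding K_system_iff[OF fam] by (auto simp: product_system_def linear_zero)
qed

text \<open>The blocks are coupled only through the equation for \<open>t\<close>. For fixed
  \<open>s\<close>, every conic constraint involves a single block, so the variables
  \<open>u\<close> can be eliminated block by block.\<close>

lemma projection_product_system:
  fixes U :: "'k::finite \<Rightarrow> 'u::euclidean_space set"
    and E :: "'k \<Rightarrow> 'e::euclidean_space set"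
  shows "(t, g, x) \<in> projection (block_prod E) (UNIV \<times> block_prod U) (product_system n K X G T B a)
    \<longleftrightarrow> (\<exists>s. t = (\<Sum>k\<in>UNIV. s k) \<and> (\<forall>k. (s k, g $ k, x $ k) \<in>
           projection (E k) (U k) {Conic (n k) (K k) (X k) (G k) (T k) (B k) (a k)}))"
    (is "?L \<longleftrightarrow> ?R")
proof
  assume ?L
  then obtain s u where "g \<in> block_prod E" "x \<in> block_prod E" "u \<in> block_prod U"
    and "\<forall>c\<in>product_system n K X G T B a. satisfies t g x (s, u) c"
    by (auto simp: projection_def solution_set_def)
  \<comment> \<open>Associativity regroups the \<open>T k\<close> term, which the product system
    keeps together with the \<open>B k\<close> term.\<close>
  then show ?R
    by (intro exI[of _ "\<lambda>k. s $ k"])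
       (auto simp: projection_def solution_set_def block_prod_def product_system_def add.assoc)
next
  assume ?R
  then obtain s where t: "t = (\<Sum>k\<in>UNIV. s k)" and
    "\<forall>k. \<exists>u. (s k, g $ k, x $ k, u) \<in>
      solution_set (E k) (U k) {Conic (n k) (K k) (X k) (G k) (T k) (B k) (a k)}"
    by (auto simp: projection_def)
  \<comment> \<open>A choice over \<open>k\<close> gathers the separate block witnesses into one
    family.\<close>
  then obtain u where "(s k, g $ k, x $ k, u k) \<in>
      solution_set (E k) (U k) {Conic (n k) (K k) (X k) (G k) (T k) (B k) (a k)}" for k
    by metis
  with t have "(t, g, x, (\<chi> k. s k), (\<chi> k. u k)) \<in>
      solution_set (block_prod E) (UNIV \<times> block_prod U) (product_system n K X G T B a)"
    by (auto simp: solution_set_def block_prod_def product_system_def add.assoc)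
  then show ?L by (auto simp: projection_def)
qed

text \<open>The surplus is shared evenly so that a positive surplus is positive in every block.\<close>

lemma sum_add_average:
  fixes s :: "'k::finite \<Rightarrow> real"
  shows "(\<Sum>k\<in>UNIV. s k + (t - (\<Sum>k\<in>UNIV. s k)) / CARD('k)) = t"
  by (simp add: sum.distrib)

text \<open>Containment in \<open>FF\<close> follows by adding the block inequalities; upward
  closure follows by splitting an increase of \<open>t\<close> into equal increases of the
  \<open>s k\<close>.\<close>

lemma rep_sound_block:
  fixes F :: "'k::finite \<Rightarrow> 'e::euclidean_space \<Rightarrow> 'e"
  assumes sound: "\<And>k. rep_sound (E k) (F k) (\<X> k) (P k)"
    and Q: "\<And>t g x. (t, g, x) \<in> Q \<longleftrightarrow>
      (\<exists>s. t = (\<Sum>k\<in>UNIV. s k) \<and> (\<forall>k. (s k, g $ k, x $ k) \<in> P k))"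
  shows "rep_sound (block_prod E) (block_field F) (block_prod \<X>) Q"
proof -
  have "(t, g, x) \<in> FF (block_prod E) (block_field F) (block_prod \<X>)" if "(t, g, x) \<in> Q" for t g x
  proof -
    obtain s where t: "t = (\<Sum>k\<in>UNIV. s k)" and "\<And>k. (s k, g $ k, x $ k) \<in> P k"
      using \<open>(t, g, x) \<in> Q\<close> unfolding Q by blast
    then have *: "(s k, g $ k, x $ k) \<in> FF (E k) (F k) (\<X> k)" for k
      using sound unfolding rep_sound_def by blast
    have "block_field F y \<bullet> (x - y) \<le> t - g \<bullet> y" if "y \<in> block_prod \<X>" for y
    proof -
      have "block_field F y \<bullet> (x - y) = (\<Sum>k\<in>UNIV. F k (y $ k) \<bullet> (x $ k - y $ k))"
        by (simp add: inner_vec_def block_field_def)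
      \<comment> \<open>The inequality defining \<open>FF\<close> for block \<open>k\<close> is used
        at the test point \<open>y $ k\<close>, which lies in the block domain because
        \<open>y\<close> lies in the product.\<close>
      also have "\<dots> \<le> (\<Sum>k\<in>UNIV. s k - (g $ k) \<bullet> (y $ k))"
        using that * by (intro sum_mono) (auto simp: FF_def block_prod_def)
      also have "\<dots> = t - g \<bullet> y"
        by (simp add: inner_vec_def t sum_subtractf)
      finally show ?thesis .
    qed
    then show ?thesis using * by (auto simp: FF_def block_prod_def)
  qed
  moreover have "(t', g, x) \<in> Q" if "(t, g, x) \<in> Q" "t \<le> t'" for t g x t'
  proof -
    obtain s where t: "t = (\<Sum>k\<in>UNIV. s k)" and s: "\<And>k. (s k, g $ k, x $ k) \<in> P k"
      using \<open>(t, g, x) \<in> Q\<close> unfolding Q by blast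
    \<comment> \<open>Every share is nonnegative, so the upward closure of each \<open>P k\<close>
      applies separately.\<close>
    have "s k \<le> s k + (t' - t) / CARD('k)" for k using that(2) by simp
    then have "(s k + (t' - t) / CARD('k), g $ k, x $ k) \<in> P k" for k
      using s sound unfolding rep_sound_def by blast
    then show ?thesis unfolding Q t by (metis sum_add_average)
  qed
  ultimately show ?thesis unfolding rep_sound_def by auto
qed

theorem mainTheorem16:
  fixes \<K> :: "nat \<Rightarrow> (nat \<Rightarrow> real) set set"
    and E :: "'k::finite \<Rightarrow> 'e::euclidean_space set"
    and \<X> :: "'k \<Rightarrow> 'e set"
    and F :: "'k \<Rightarrow> 'e \<Rightarrow> 'e"
    and U :: "'k \<Rightarrow> 'u::euclidean_space set"
    and n :: "'k \<Rightarrow> nat"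
    and K :: "'k \<Rightarrow> (nat \<Rightarrow> real) set"
    and X G :: "'k \<Rightarrow> 'e \<Rightarrow> nat \<Rightarrow> real"
    and T a :: "'k \<Rightarrow> nat \<Rightarrow> real"
    and B :: "'k \<Rightarrow> 'u \<Rightarrow> nat \<Rightarrow> real"
  assumes "cone_family \<K>"
    and "\<And>k. monotone_field (E k) (\<X> k) (F k)"
  shows "((\<forall>k. K_representation \<K> (E k) (U k)
              {Conic (n k) (K k) (X k) (G k) (T k) (B k) (a k)} (F k) (\<X> k)) \<longrightarrow>
          K_representation \<K> (block_prod E) (UNIV \<times> block_prod U)
            (product_system n K X G T B a) (block_field F) (block_prod \<X>))
       \<and> ((\<forall>k. almost_K_representation \<K> (E k) (U k)
              {Conic (n k) (K k) (X k) (G k) (T k) (B k) (a k)} (F k) (\<X> k)) \<longrightarrow>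
          almost_K_representation \<K> (block_prod E) (UNIV \<times> block_prod U)
            (product_system n K X G T B a) (block_field F) (block_prod \<X>))"
proof (intro conjI impI)
  let ?P = "\<lambda>k. projection (E k) (U k) {Conic (n k) (K k) (X k) (G k) (T k) (B k) (a k)}"
  let ?Q = "projection (block_prod E) (UNIV \<times> block_prod U) (product_system n K X G T B a)"
  \<comment> \<open>The facts before the braces serve both halves, which differ only in the
    inclusion of points over the graph of the field.\<close>
  have mon: "monotone_field (block_prod E) (block_prod \<X>) (block_field F)"
    using assms(2) by (rule monotone_field_block)
  have sub: "subspace (UNIV \<times> block_prod U)" if "\<And>k. subspace (U k)"
    using that by (intro subspace_Times subspace_UNIV subspace_block_prod)
  have sys: "K_system \<K> (block_prod E) (UNIV \<times> block_prod U) (product_system n K X G T B a)"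
    if "\<And>k. K_system \<K> (E k) (U k) {Conic (n k) (K k) (X k) (G k) (T k) (B k) (a k)}"
    using that by (intro K_system_product_system assms(1)) (simp add: K_system_def)
  have sound: "rep_sound (block_prod E) (block_field F) (block_prod \<X>) ?Q"
    if "\<And>k. rep_sound (E k) (F k) (\<X> k) (?P k)"
    using that projection_product_system by (rule rep_sound_block)
  have inner: "block_field F x \<bullet> x = (\<Sum>k\<in>UNIV. F k (x $ k) \<bullet> (x $ k))" for x
    by (simp add: inner_vec_def block_field_def)
  have nth: "block_field F x $ k = F k (x $ k)" for x k
    by (simp add: block_field_def)
  {
    assume rep: "\<forall>k. K_representation \<K> (E k) (U k)
        {Conic (n k) (K k) (X k) (G k) (T k) (B k) (a k)} (F k) (\<X> k)"
    have "(block_field F x \<bullet> x, block_field F x, x) \<in> ?Q" if "x \<in> block_prod \<X>" for x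
    proof -
      \<comment> \<open>In the exact case each \<open>s k\<close> is the block inner product, and by
        \<open>inner\<close> these add up to exactly the required \<open>t\<close>.\<close>
      have "(F k (x $ k) \<bullet> (x $ k), F k (x $ k), x $ k) \<in> ?P k" for k
        using rep that unfolding K_representation_def block_prod_def by blast
      then show ?thesis unfolding projection_product_system inner nth by blast
    qed
    then show "K_representation \<K> (block_prod E) (UNIV \<times> block_prod U)
        (product_system n K X G T B a) (block_field F) (block_prod \<X>)"
      using mon sub sys sound rep unfolding K_representation_def by blast
  next
    assume rep: "\<forall>k. almost_K_representation \<K> (E k) (U k)
        {Conic (n k) (K k) (X k) (G k) (T k) (B k) (a k)} (F k) (\<X> k)"
    have "(t, block_field F x, x) \<in> ?Q"
      if "x \<in> block_prod \<X>" "block_field F x \<bullet> x < t" for x t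
    proof -
      \<comment> \<open>The block inner product alone would only give equality, whereas an almost
        representation demands strict excess in every block. An equal share of the positive total
        surplus provides it and keeps the sum equal to \<open>t\<close>.\<close>
      let ?s = "\<lambda>k. F k (x $ k) \<bullet> (x $ k) + (t - block_field F x \<bullet> x) / CARD('k)"
      have "F k (x $ k) \<bullet> (x $ k) < ?s k" for k using that(2) by simp
      then have "(?s k, F k (x $ k), x $ k) \<in> ?P k" for k
        using rep that(1) unfolding almost_K_representation_def block_prod_def by blast
      moreover have "t = (\<Sum>k\<in>UNIV. ?s k)" unfolding inner by (rule sum_add_average[symmetric])
      ultimately show ?thesis unfolding projection_product_system nth by blast
    qed
    then show "almost_K_representation \<K> (block_prod E) (UNIV \<times> block_prod U)
        (product_system n K X G T B a) (block_field F) (block_prod \<X>)"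
      using mon sub sys sound rep unfolding almost_K_representation_def by blast
  }
qed

end
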